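(* Let $q=2^{2e+1}>2$. Then an ${\rm O}^+(8,q)$-space has a maximal orthogonal partial spread of size $q^2-q+1$, and this is also a maximal symplectic partial spread of the associated ${\rm Sp}(8,q)$-space.
   Context: An ${\rm O}^+(8,q)$-space is an $8$-dimensional $\mathbb{F}_q$-space with a nondegenerate quadratic form $Q$ of plus type; for $q$ even its polar form $f(u,v)=Q(u+v)-Q(u)-Q(v)$ is nondegenerate alternating, making the space an ${\rm Sp}(8,q)$-space. An orthogonal (resp. symplectic) partial spread is a set of $4$-dimensional subspaces on which $Q$ (resp. $f$) vanishes, pairwise meeting only in $0$; maximal means not properly contained in another such. *)

theory Defs
  imports Complex_Main
begin

definition polar :: "('v::ab_group_add \<Rightarrow> 'a::field) \<Rightarrow> 'v \<Rightarrow> 'v \<Rightarrow> 'a" where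
  "polar Q u v = Q (u + v) - Q u - Q v"

text \<open>
  The polar form is symmetric by construction, so linearity in its second argument
  is bilinearity.
\<close>

locale quadratic_space = vector_space scale
  for scale :: "'a::field \<Rightarrow> 'v::ab_group_add \<Rightarrow> 'v" (infixr "*s" 75) +
  fixes Q :: "'v \<Rightarrow> 'a"
  assumes Q_scale: "Q (a *s v) = a\<^sup>2 * Q v"
    and polar_linear: "Vector_Spaces.linear scale (*) (polar Q u)"
begin

definition totally_singular :: "'v set \<Rightarrow> bool" where
  "totally_singular W \<longleftrightarrow> subspace W \<and> (\<forall>v\<in>W. Q v = 0)"

definition totally_isotropic :: "'v set \<Rightarrow> bool" where
  "totally_isotropic W \<longleftrightarrow> subspace W \<and> (\<forall>u\<in>W. \<forall>v\<in>W. polar Q u v = 0)"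

definition witt_index :: nat where
  "witt_index = Max {dim W | W. totally_singular W}"

definition orthogonal_partial_spread :: "'v set set \<Rightarrow> bool" where
  "orthogonal_partial_spread S \<longleftrightarrow>
     (\<forall>W\<in>S. totally_singular W \<and> dim W = 4) \<and>
     (\<forall>W\<in>S. \<forall>X\<in>S. W \<noteq> X \<longrightarrow> W \<inter> X = {0})"

definition symplectic_partial_spread :: "'v set set \<Rightarrow> bool" where
  "symplectic_partial_spread S \<longleftrightarrow>
     (\<forall>W\<in>S. totally_isotropic W \<and> dim W = 4) \<and>
     (\<forall>W\<in>S. \<forall>X\<in>S. W \<noteq> X \<longrightarrow> W \<inter> X = {0})"

definition maximal_orthogonal_partial_spread :: "'v set set \<Rightarrow> bool" where
  "maximal_orthogonal_partial_spread S \<longleftrightarrow>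
     orthogonal_partial_spread S \<and> \<not> (\<exists>T. orthogonal_partial_spread T \<and> S \<subset> T)"

definition maximal_symplectic_partial_spread :: "'v set set \<Rightarrow> bool" where
  "maximal_symplectic_partial_spread S \<longleftrightarrow>
     symplectic_partial_spread S \<and> \<not> (\<exists>T. symplectic_partial_spread T \<and> S \<subset> T)"

end

text \<open>
  Nondegeneracy is the characteristic-free condition that the radical of the polar form
  contains no nonzero singular vector. In the presence of plus type (Witt index half the
  dimension) it forces the polar form itself to be nondegenerate: if \<open>W\<close> is totally singular
  of dimension 4, it meets the radical trivially, so its orthogonal complement has
  dimension 4 and hence equals \<open>W\<close>; the radical lies in that complement, so it is zero.

  The assumption \<open>dim UNIV = 8\<close> entails finite dimension, since \<open>dim\<close> is 0 on
  infinite-dimensional spaces.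
\<close>

locale O_plus_8_space = quadratic_space scale Q
  for scale :: "'a::field \<Rightarrow> 'v::ab_group_add \<Rightarrow> 'v" (infixr "*s" 75)
    and Q :: "'v \<Rightarrow> 'a" +
  assumes dim_8: "dim UNIV = 8"
    and nondegenerate: "\<lbrakk>Q v = 0; \<And>w. polar Q v w = 0\<rbrakk> \<Longrightarrow> v = 0"
    and plus_type: "witt_index = 4"

end

theory Submission
  imports Defs
begin

text \<open>
  Write the space as \<open>V = V\<^sub>4 \<otimes> V\<^sub>2\<close> with \<open>V\<^sub>4\<close>, \<open>V\<^sub>2\<close> symplectic. If \<open>L\<close> is a totally isotropic
  line of \<open>V\<^sub>4\<close>, then \<open>L \<otimes> V\<^sub>2\<close> is a totally singular 4-space, so partial spreads of \<open>Sp(4,q)\<close>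
  give orthogonal partial spreads. Take the Lueneburg spread of \<open>V\<^sub>4\<close> and replace the \<open>q + 1\<close>
  members that meet a totally isotropic line \<open>L\<^sub>0\<close> outside the spread by \<open>L\<^sub>0\<close> itself; this leaves
  \<open>q\<^sup>2 - q + 1\<close> lines.

  Let \<open>W\<close> be totally isotropic of dimension 4 and disjoint from \<open>L\<^sub>0 \<otimes> V\<^sub>2\<close>, hence the graph of a
  linear map \<open>N\<close>. On \<open>W\<close> the form \<open>Q\<close> is the square of a linear functional, and on the kernel of
  that functional \<open>N\<close> agrees with a map \<open>N'\<close> whose graph is totally singular. The graph of \<open>N'\<close>
  meets a member \<open>L \<otimes> V\<^sub>2\<close> nontrivially if and only if a Pfaffian vanishes, and then in dimension at
  least 2, so that \<open>W\<close> meets it too. The Pfaffian condition says that a hyperplane of the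
  \<open>O(5,q)\<close>-space meets the Suzuki-Tits ovoid outside the \<open>q + 1\<close> removed points; this is where
  \<open>q > 2\<close> is needed. Thus the partial spread is maximal already among symplectic ones.
\<close>

section \<open>Fields with a Tits endomorphism\<close>

locale tits_endomorphism =
  fixes \<sigma> :: "'a::{field,finite} \<Rightarrow> 'a"
  assumes two_eq_0: "(2::'a) = 0"
    and sigma_add: "\<sigma> (x + y) = \<sigma> x + \<sigma> y"
    and sigma_mult: "\<sigma> (x * y) = \<sigma> x * \<sigma> y"
    and sigma_sigma: "\<sigma> (\<sigma> x) = x\<^sup>2"
    and card_gt_4: "card (UNIV :: 'a set) > 4"
begin

section \<open>Characteristic 2 and the fixed points of the Tits endomorphism\<close>

lemma add_self [simp]: "x + x = (0::'a)"
  by (metis mult_2 mult_zero_left two_eq_0)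

lemma add_eq_0_iff_eq: "x + y = 0 \<longleftrightarrow> x = (y::'a)"
  by (metis add.assoc add.right_neutral add_self add.commute)

lemma add_cancel_self [simp]: "x + (x + y) = (y::'a)"
  by (simp add: add.assoc [symmetric])

lemma uminus_eq [simp]: "- x = (x::'a)"
  by (metis add_self minus_unique)

lemma square_add: "(x + y)\<^sup>2 = x\<^sup>2 + (y\<^sup>2::'a)"
  by (simp add: power2_sum two_eq_0)

lemma square_eq_iff: "x\<^sup>2 = y\<^sup>2 \<longleftrightarrow> x = (y::'a)"
  by (metis add_eq_0_iff_eq square_add zero_eq_power2)

lemma sigma_eq_iff [simp]: "\<sigma> x = \<sigma> y \<longleftrightarrow> x = y"
  by (metis sigma_sigma square_eq_iff)

lemma sigma_0 [simp]: "\<sigma> 0 = 0"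
  using sigma_add [of 0 0] by simp

lemma sigma_eq_0_iff [simp]: "\<sigma> x = 0 \<longleftrightarrow> x = 0"
  by (metis sigma_0 sigma_eq_iff)

lemma sigma_1 [simp]: "\<sigma> 1 = 1"
  by (metis mult_cancel_left mult_1 mult_1_right sigma_eq_0_iff sigma_mult zero_neq_one)

lemma sigma_divide: "\<sigma> (x / y) = \<sigma> x / \<sigma> y"
proof (cases "y = 0")
  case False
  then have "\<sigma> (x / y) * \<sigma> y = \<sigma> x" by (simp flip: sigma_mult)
  with False show ?thesis by (simp add: eq_divide_eq)
qed simp

lemma square_eq_self_iff: "x\<^sup>2 = x \<longleftrightarrow> x = 0 \<or> x = (1::'a)"
  by (simp add: power2_eq_square)

text \<open>A fixed point of \<open>\<sigma>\<close> is also fixed by squaring, so it lies in the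
  prime field.\<close>

lemma sigma_eq_self_iff: "\<sigma> x = x \<longleftrightarrow> x = 0 \<or> x = 1"
  by (metis sigma_0 sigma_1 sigma_sigma square_eq_self_iff)

lemma square_eq_sigma_iff: "x\<^sup>2 = \<sigma> x \<longleftrightarrow> x = 0 \<or> x = 1"
  by (metis sigma_eq_iff sigma_sigma sigma_eq_self_iff)

lemma additive_surj:
  fixes f :: "'a \<Rightarrow> 'a"
  assumes add: "\<And>x y. f (x + y) = f x + f y" and ker: "\<And>x. f x = 0 \<Longrightarrow> x = 0"
  shows "\<exists>x. f x = y"
proof -
  have "inj f"
  proof (rule injI)
    fix x y assume "f x = f y"
    then have "f (x + y) = 0" by (simp add: add)
    then show "x = y" by (metis ker add_eq_0_iff_eq)
  qed
  then have "surj f" by (rule finite_UNIV_inj_surj[OF finite])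
  then obtain x where "y = f x" by (rule surjE)
  then show ?thesis by blast
qed

lemma surj_square: "\<exists>y. y\<^sup>2 = (x::'a)"
  by (rule additive_surj) (simp_all add: square_add)

lemma surj_sigma: "\<exists>y. \<sigma> y = x"
  by (rule additive_surj) (simp_all add: sigma_add)

lemma exists_not_01: obtains u :: 'a where "u \<noteq> 0" "u \<noteq> 1"
proof -
  have "card {0, 1::'a} \<le> 2" by (simp add: card_insert_if)
  with card_gt_4 have "{0, 1::'a} \<noteq> UNIV" by (intro notI) simp
  then show ?thesis using that by auto
qed

text \<open>Put \<open>x = a\<close> and \<open>y = \<delta> a b\<close>. As
  \<open>\<sigma> y = x\<^sup>2 * \<sigma> x + b\<^sup>2\<close>, the determinant
  \<open>a * y + b\<^sup>2\<close> equals
  \<open>x * y + x\<^sup>2 * \<sigma> x + \<sigma> y\<close>, the affine equation of the Suzuki-Tits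
  ovoid. The section lemmas evaluate a linear form at
  \<open>(1, a, b, \<delta> a b, a * \<delta> a b + b\<^sup>2)\<close>.\<close>

definition \<delta> :: "'a \<Rightarrow> 'a \<Rightarrow> 'a" where
  "\<delta> a b = \<sigma> a * a + \<sigma> b"

text \<open>
  The symmetric matrices with rows \<open>(a, b)\<close> and \<open>(b, \<delta> a b)\<close> represent the members of the Lueneburg
  spread other than \<open>{0} \<times> F\<^sup>2\<close>; two members are disjoint because the difference of their matrices
  is invertible.
\<close>

lemma det_difference_eq_0:
  assumes "(a + a') * (\<delta> a b + \<delta> a' b') = (b + b')\<^sup>2"
  shows "a = a' \<and> b = b'"
proof (cases "a = a'")
  case True
  then show ?thesis using assms by (simp add: square_eq_iff add_eq_0_iff_eq)
next
  case False
  define x where "x = a + a'"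
  define y where "y = b + b'"
  have x0: "x \<noteq> 0" using False by (simp add: x_def add_eq_0_iff_eq)
  have a': "a' = a + x" and b': "b' = b + y" by (simp_all add: x_def y_def)
  have 1: "x * (\<sigma> a * x + \<sigma> x * a + \<sigma> x * x + \<sigma> y) = y\<^sup>2"
  proof -
    have "a + a' = x" "b + b' = y" by (simp_all add: x_def y_def)
    moreover have "\<delta> a b + \<delta> a' b' = \<sigma> a * x + \<sigma> x * a + \<sigma> x * x + \<sigma> y"
      unfolding a' b' \<delta>_def by (simp add: sigma_add distrib_left distrib_right add_ac)
    ultimately show ?thesis using assms by simp
  qed
  \<comment> \<open>Dividing 1 by \<open>x\<^sup>2 * \<sigma> x\<close> leaves a relation between
    \<open>t\<close>, \<open>u\<close> and their images under \<open>\<sigma>\<close>.\<close>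
  define t where "t = a / x"
  have a: "a = t * x" using x0 by (simp add: t_def)
  define u where "u = \<sigma> y / (\<sigma> x * x)"
  have su: "\<sigma> u = y\<^sup>2 / (x\<^sup>2 * \<sigma> x)" by (simp add: u_def sigma_divide sigma_mult sigma_sigma)
  have "\<sigma> t + t + 1 + u = \<sigma> u"
  proof -
    have "u * (\<sigma> x * x) = \<sigma> y" using x0 by (simp add: u_def)
    then have "(\<sigma> t + t + 1 + u) * (x\<^sup>2 * \<sigma> x) = x * (\<sigma> t * \<sigma> x * x + \<sigma> x * (t * x) + \<sigma> x * x + \<sigma> y)"
      by (simp add: algebra_simps power2_eq_square)
    also have "\<sigma> t * \<sigma> x = \<sigma> a" using a by (simp add: sigma_mult)
    also have "t * x = a" using a by simp
    finally have "(\<sigma> t + t + 1 + u) * (x\<^sup>2 * \<sigma> x) = x * (\<sigma> a * x + \<sigma> x * a + \<sigma> x * x + \<sigma> y)" .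
    also have "\<dots> = y\<^sup>2" by (rule 1)
    finally have "(\<sigma> t + t + 1 + u) * (x\<^sup>2 * \<sigma> x) = y\<^sup>2" .
    then show ?thesis using x0 by (simp add: su eq_divide_eq)
  qed
  then have "\<sigma> t + (\<sigma> t + t + 1 + u) = \<sigma> t + \<sigma> u" by simp
  then have "(u + t) + 1 = \<sigma> u + \<sigma> t" by (simp add: add_ac)
  \<comment> \<open>Applying \<open>\<sigma>\<close> once more shows that \<open>u + t\<close>
    equals its own square, so it is 0 or 1 and \<open>\<sigma>\<close> fixes it, which contradicts
    this equation.\<close>
  then have w: "(u + t) + 1 = \<sigma> (u + t)" by (simp add: sigma_add)
  then have "\<sigma> (u + t) + 1 = (u + t)\<^sup>2" by (metis sigma_1 sigma_add sigma_sigma)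
  then have "(u + t)\<^sup>2 = u + t" using w by (metis add.assoc add.right_neutral add_self)
  then have "\<sigma> (u + t) = u + t" by (auto simp: square_eq_self_iff)
  with w show ?thesis by simp
qed

section \<open>Hyperplane sections of the Suzuki-Tits ovoid\<close>

lemma additive_index_2:
  fixes f :: "'a \<Rightarrow> 'a"
  assumes add: "\<And>x y. f (x + y) = f x + f y" and ker: "\<And>x. f x = 0 \<longleftrightarrow> x = 0 \<or> x = t"
    and t: "t \<noteq> 0"
  shows "2 * card (range f) = card (UNIV :: 'a set)"
proof -
  have fib: "card (f -` {y}) = 2" if y: "y \<in> range f" for y
  proof -
    obtain x where x: "f x = y" using y by auto
    have "f -` {y} = {x, x + t}"
    proof (intro set_eqI)
      fix z
      have "f z = y \<longleftrightarrow> f (z + x) = 0" by (simp add: add x add_eq_0_iff_eq)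
      also have "\<dots> \<longleftrightarrow> z + x = 0 \<or> z + x = t" by (rule ker)
      also have "\<dots> \<longleftrightarrow> z = x \<or> z = x + t"
        using add_cancel_self[of x z] add_cancel_self[of x t] by (auto simp: add.commute add_eq_0_iff_eq)
      finally show "z \<in> f -` {y} \<longleftrightarrow> z \<in> {x, x + t}" by simp
    qed
    then show ?thesis using t by simp
  qed
  have "card (UNIV :: 'a set) = card (\<Union>y\<in>range f. f -` {y})" by (rule arg_cong[of _ _ card]) auto
  also have "\<dots> = (\<Sum>y\<in>range f. card (f -` {y}))" by (rule card_UN_disjoint) auto
  also have "\<dots> = 2 * card (range f)" by (simp add: fib)
  finally show ?thesis by simp
qed

text \<open>The range and its coset by \<open>u\<close> exhaust the field, so
  \<open>v = u + h\<close> with \<open>h\<close> in the range, and \<open>u\<close> cancels.\<close>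

lemma index_2_add:
  fixes f :: "'a \<Rightarrow> 'a"
  assumes add: "\<And>x y. f (x + y) = f x + f y" and ind: "2 * card (range f) = card (UNIV :: 'a set)"
    and u: "u \<notin> range f" and v: "v \<notin> range f"
  shows "u + v \<in> range f"
proof -
  define H where "H = range f"
  have cl: "x + y \<in> H" if "x \<in> H" "y \<in> H" for x y
    using that by (auto simp: H_def simp flip: add)
  have disj: "u + h \<notin> H" if "h \<in> H" for h
    using cl[OF _ that, of "u + h"] u by (auto simp: H_def add.assoc)
  have "card (H \<union> (+) u ` H) = card H + card ((+) u ` H)"
    by (rule card_Un_disjoint) (use disj in auto)
  also have "card ((+) u ` H) = card H" by (rule card_image) simp
  finally have "H \<union> (+) u ` H = UNIV" using ind by (intro card_subset_eq) (auto simp: H_def)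
  then have "v \<in> (+) u ` H" using v by (auto simp: H_def)
  then obtain h where "h \<in> H" "v = u + h" by blast
  then show ?thesis by (simp add: H_def)
qed

text \<open>
  For fixed \<open>a\<close> the left-hand side is an additive function of \<open>b\<close> plus a constant, and the additive
  part depends only on \<open>g = p * a + 1\<close>. It has a nontrivial kernel only if \<open>g\<close> is a value of the
  function \<open>h\<close> below on nonzero arguments; as \<open>h\<close> is not injective, it misses a \<open>g \<noteq> 1\<close>.
\<close>

lemma section_nonlinear:
  assumes p: "p \<noteq> 0"
  shows "\<exists>a b. a \<noteq> 0 \<and> p * (a * \<delta> a b + b\<^sup>2) + \<delta> a b + T * b + K * a + s = 0"
proof -
  have "\<exists>g. g \<noteq> 1 \<and> (\<forall>c. \<exists>b. g * \<sigma> b + p * b\<^sup>2 + T * b = c)"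
  proof (cases "T = 0")
    case True
    \<comment> \<open>The choice \<open>g = 0\<close> removes the term in \<open>\<sigma> b\<close>,
      and squaring is onto.\<close>
    have "\<exists>b. p * b\<^sup>2 = c" for c using surj_square[of "c / p"] p by (metis nonzero_mult_div_cancel_left times_divide_eq_right)
    then show ?thesis using True by (intro exI[of _ 0]) simp
  next
    case T: False
    define h where "h b = (p * b\<^sup>2 + T * b) / \<sigma> b" for b
    obtain u :: 'a where u: "u \<noteq> 0" "u \<noteq> 1" by (rule exists_not_01)
    have u2: "u\<^sup>2 + \<sigma> u \<noteq> 0" and u1: "\<sigma> u + u \<noteq> 0"
      using u by (auto simp: add_eq_0_iff_eq square_eq_sigma_iff sigma_eq_self_iff)
    \<comment> \<open>This solves \<open>h (u * b) = h b\<close>, which is linear in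
      \<open>b\<close> once \<open>b\<close> is nonzero.\<close>
    define b where "b = T * (\<sigma> u + u) / (p * (u\<^sup>2 + \<sigma> u))"
    have b0: "b \<noteq> 0" using T p u1 u2 by (simp add: b_def)
    have pb: "p * b * (u\<^sup>2 + \<sigma> u) = T * (\<sigma> u + u)" using p u2 by (simp add: b_def)
    have "h (u * b) = h b"
    proof -
      have "p * b * u\<^sup>2 + T * u = (p * b + T) * \<sigma> u"
        using pb by (simp add: algebra_simps) (metis add.assoc add.commute add_cancel_self)
      then have "(p * b * u\<^sup>2 + T * u) * b = (p * b + T) * \<sigma> u * b" by simp
      then show ?thesis using b0 u by (simp add: h_def sigma_mult field_simps power2_eq_square)
    qed
    moreover have "u * b \<noteq> b" using u b0 by simp
    ultimately have "\<not> inj_on h (UNIV - {0})" using b0 u inj_onD[of h "UNIV - {0}" "u * b" b] by auto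
    then have "card (h ` (UNIV - {0})) < card (UNIV - {0::'a})"
      by (meson card_image_le eq_card_imp_inj_on finite finite_Diff le_neq_implies_less)
    also have "\<dots> = card (UNIV - {1::'a})" by (simp add: card_Diff_singleton)
    finally have "\<not> UNIV - {1} \<subseteq> h ` (UNIV - {0})" by (meson card_mono finite leD)
    then obtain g where g: "g \<noteq> 1" "g \<notin> h ` (UNIV - {0})" by auto
    have "\<exists>b. g * \<sigma> b + p * b\<^sup>2 + T * b = c" for c
    proof (rule additive_surj)
      fix x assume x: "g * \<sigma> x + p * x\<^sup>2 + T * x = 0"
      show "x = 0"
      proof (rule ccontr)
        assume "x \<noteq> 0"
        moreover have "g * \<sigma> x = p * x\<^sup>2 + T * x" using x by (simp add: add_eq_0_iff_eq add.assoc)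
        ultimately have "g = h x" by (simp add: h_def eq_divide_eq)
        then show False using g \<open>x \<noteq> 0\<close> by auto
      qed
    qed (simp add: sigma_add square_add algebra_simps)
    then show ?thesis using g by blast
  qed
  then obtain g where g1: "g \<noteq> 1" and g: "\<And>c. \<exists>b. g * \<sigma> b + p * b\<^sup>2 + T * b = c" by blast
  define a where "a = (g + 1) / p"
  have a0: "a \<noteq> 0" using g1 p by (simp add: a_def add_eq_0_iff_eq)
  have ga: "p * a + 1 = g" using p by (simp add: a_def add.assoc)
  obtain b where b: "g * \<sigma> b + p * b\<^sup>2 + T * b = p * a * \<sigma> a * a + \<sigma> a * a + K * a + s" using g by blast
  have "p * (a * \<delta> a b + b\<^sup>2) + \<delta> a b + T * b + K * a + s
     = ((p * a + 1) * \<sigma> b + p * b\<^sup>2 + T * b) + (p * a * \<sigma> a * a + \<sigma> a * a + K * a + s)"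
    by (simp add: \<delta>_def algebra_simps)
  also have "\<dots> = 0" by (simp add: ga b)
  finally show ?thesis using a0 by blast
qed

text \<open>
  Here the additive function of \<open>b\<close> does not depend on \<open>a\<close>. If it is not onto, its range has index
  2, and no solution would force \<open>\<phi>\<close> to be constant off \<open>0\<close> modulo the range; polarising \<open>\<phi>\<close> twice
  puts all \<open>\<sigma> z * y + z * \<sigma> y\<close>, and then everything, into the range.
\<close>

lemma section_linear:
  "\<exists>a b. a \<noteq> 0 \<and> \<delta> a b + T * b + K * a + s = 0"
proof (rule ccontr)
  assume no: "\<not> ?thesis"
  define f where "f b = \<sigma> b + T * b" for b
  define \<phi> where "\<phi> a = \<sigma> a * a + K * a" for a
  have f_add: "f (x + y) = f x + f y" for x y by (simp add: f_def sigma_add algebra_simps)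
  have out: "\<phi> a + s \<notin> range f" if "a \<noteq> 0" for a
  proof
    assume "\<phi> a + s \<in> range f"
    then obtain b where "\<phi> a + s = f b" by auto
    then have "\<phi> a + s + f b = 0" by simp
    then have "\<delta> a b + T * b + K * a + s = 0" by (simp add: f_def \<phi>_def \<delta>_def add_ac)
    then show False using no that by blast
  qed
  \<comment> \<open>A trivial kernel would make \<open>f\<close> onto, so that it would hit
    \<open>\<phi> 1 + s\<close>.\<close>
  obtain t where t: "t \<noteq> 0" "f t = 0"
    using additive_surj[of f] f_add out[of 1] by (metis one_neq_zero rangeI)
  have ker: "f x = 0 \<longleftrightarrow> x = 0 \<or> x = t" for x
  proof
    assume "f x = 0"
    then have "\<sigma> x * t = x * \<sigma> t" using t by (simp add: f_def add_eq_0_iff_eq)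
    then have "\<sigma> (x / t) = x / t" using t by (simp add: sigma_divide frac_eq_eq)
    then show "x = 0 \<or> x = t" using t by (auto simp: sigma_eq_self_iff)
  qed (use t in \<open>auto simp: f_def\<close>)
  note ind = additive_index_2[of f, OF f_add ker t(1)]
  have cl: "x + y \<in> range f" if "x \<in> range f" "y \<in> range f" for x y using that by (auto simp flip: f_add)
  have 1: "\<phi> x + \<phi> y \<in> range f" if "x \<noteq> 0" "y \<noteq> 0" for x y
    using index_2_add[of f, OF f_add ind out[OF that(1)] out[OF that(2)]] by (simp add: add_ac)
  have polar_in: "\<sigma> z * y + z * \<sigma> y \<in> range f" for y z
  proof (cases "y = 0 \<or> z = 0")
    case True
    then show ?thesis by (auto simp: f_def intro: range_eqI[of _ _ 0])
  next
    case False

    \<comment> \<open>Avoiding these four values makes both \<open>x\<close> and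
      \<open>x + z\<close> nonzero and different from \<open>y\<close>. Adding the two instances of
      * then cancels \<open>\<phi> y\<close> and all terms in \<open>x\<close>.\<close>
    have "card {0, y, z, z + y} \<le> 4" by (simp add: card_insert_if)
    with card_gt_4 have "{0, y, z, z + y} \<noteq> UNIV" by (intro notI) simp
    then obtain x where x: "x \<noteq> 0" "x \<noteq> y" "x \<noteq> z" "x \<noteq> z + y" by auto
    have *: "\<phi> y + \<sigma> w * y + w * \<sigma> y \<in> range f" if "w \<noteq> 0" "w \<noteq> y" for w
    proof -
      have "\<phi> (w + y) + \<phi> w \<in> range f" using that by (intro 1) (auto simp: add_eq_0_iff_eq)
      then show ?thesis by (simp add: \<phi>_def sigma_add algebra_simps)
    qed
    have "(\<phi> y + \<sigma> x * y + x * \<sigma> y) + (\<phi> y + \<sigma> (x + z) * y + (x + z) * \<sigma> y) \<in> range f"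
      using x by (intro cl[OF * *]) (auto simp: add_eq_0_iff_eq add_ac)
    then show ?thesis by (simp add: sigma_add algebra_simps)
  qed
  define f1 where "f1 b = \<sigma> b + b" for b
  have f1_add: "f1 (x + y) = f1 x + f1 y" for x y by (simp add: f1_def sigma_add algebra_simps)
  have ker1: "f1 x = 0 \<longleftrightarrow> x = 0 \<or> x = 1" for x by (simp add: f1_def add_eq_0_iff_eq sigma_eq_self_iff)
  \<comment> \<open>The case \<open>y = 1\<close> of \<open>polar_in\<close> gives the inclusion;
    both ranges have index 2.\<close>
  have "range f1 \<subseteq> range f" using polar_in[of _ 1] by (auto simp: f1_def add.commute)
  moreover have "2 * card (range f1) = 2 * card (range f)"
    using ind additive_index_2[of f1, OF f1_add ker1] by simp
  ultimately have eq: "range f1 = range f" by (intro card_subset_eq) auto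
  obtain y :: 'a where y: "y \<noteq> 0" "y \<noteq> 1" by (rule exists_not_01)
  have y2: "y + y\<^sup>2 \<noteq> 0" using y by (metis add_eq_0_iff_eq square_eq_self_iff)
  have "c \<in> range f" for c
  proof -
    \<comment> \<open>Adding \<open>f1 (z * \<sigma> y)\<close> cancels
      \<open>z * \<sigma> y\<close> and leaves a multiple of \<open>\<sigma> z\<close>, which can be
      any element.\<close>
    obtain z where z: "\<sigma> z = c / (y + y\<^sup>2)" using surj_sigma by blast
    have "(\<sigma> z * y + z * \<sigma> y) + f1 (z * \<sigma> y) \<in> range f"
      using eq by (intro cl polar_in) auto
    also have "(\<sigma> z * y + z * \<sigma> y) + f1 (z * \<sigma> y) = \<sigma> z * (y + y\<^sup>2)"
      by (simp add: f1_def sigma_mult sigma_sigma algebra_simps)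
    also have "\<dots> = c" using y2 by (simp add: z)
    finally show ?thesis .
  qed
  then show False using out[of 1] by simp
qed

text \<open>
  The matrix with blocks \<open>R, A\<close> and \<open>C, adj R\<close>, where \<open>R\<close> has rows \<open>(r1, r2)\<close> and \<open>(r3, r4)\<close>, is
  alternating up to a change of basis with Pfaffian \<open>A * C - det R\<close>, so its kernel, when nonzero,
  has dimension at least 2.
\<close>

lemma kernel_meets_hyperplane:
  fixes A C r1 r2 r3 r4 k1 k2 k3 k4 :: 'a
  assumes det: "A * C = r1 * r4 + r2 * r3"
  obtains c1 c2 c3 c4 where "c1 \<noteq> 0 \<or> c2 \<noteq> 0 \<or> c3 \<noteq> 0 \<or> c4 \<noteq> 0"
    "A * c3 + r1 * c1 + r2 * c2 = 0" "A * c4 + r3 * c1 + r4 * c2 = 0"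
    "r4 * c3 + r2 * c4 + C * c1 = 0" "r3 * c3 + r1 * c4 + C * c2 = 0"
    "k1 * c1 + k2 * c2 + k3 * c3 + k4 * c4 = 0"
proof -
  have lin: "\<exists>x y. (x \<noteq> 0 \<or> y \<noteq> 0) \<and> l * x + m * y = 0" for l m :: 'a
  proof (cases "m = 0")
    case True then show ?thesis by (intro exI[of _ "0::'a"] exI[of _ "1::'a"]) simp
  next
    case False then show ?thesis by - (rule exI[of _ m], rule exI[of _ l], simp add: mult.commute)
  qed
  consider "A \<noteq> 0" | "C \<noteq> 0" | "A = 0" "C = 0" by blast
  then show ?thesis
  proof cases
    case 1
    \<comment> \<open>For \<open>A\<close> nonzero, the first two equations express
      \<open>c3\<close>, \<open>c4\<close> through \<open>c1\<close>, \<open>c2\<close>, and the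
      determinant condition makes the next two automatic. The two free parameters leave room for the
      hyperplane.\<close>
    obtain x y where xy: "x \<noteq> 0 \<or> y \<noteq> 0" "(k1 * A + k3 * r1 + k4 * r3) * x + (k2 * A + k3 * r2 + k4 * r4) * y = 0"
      using lin by blast
    have C: "C * (A * z) = (r1 * r4 + r2 * r3) * z" for z by (simp add: det [symmetric] mult_ac)
    show ?thesis
    proof (rule that[of "A * x" "A * y" "r1 * x + r2 * y" "r3 * x + r4 * y"])
      show "r4 * (r1 * x + r2 * y) + r2 * (r3 * x + r4 * y) + C * (A * x) = 0"
        unfolding C by (simp add: algebra_simps)
      show "r3 * (r1 * x + r2 * y) + r1 * (r3 * x + r4 * y) + C * (A * y) = 0"
        unfolding C by (simp add: algebra_simps)
      show "k1 * (A * x) + k2 * (A * y) + k3 * (r1 * x + r2 * y) + k4 * (r3 * x + r4 * y) = 0"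
        using xy(2) by (simp add: algebra_simps)
    qed (use 1 xy in \<open>auto simp: algebra_simps\<close>)
  next
    case 2
    obtain x y where xy: "x \<noteq> 0 \<or> y \<noteq> 0" "(k3 * C + k1 * r4 + k2 * r3) * x + (k4 * C + k1 * r2 + k2 * r1) * y = 0"
      using lin by blast
    have A: "A * (C * z) = (r1 * r4 + r2 * r3) * z" for z by (simp add: det [symmetric] mult_ac)
    show ?thesis
    proof (rule that[of "r4 * x + r2 * y" "r3 * x + r1 * y" "C * x" "C * y"])
      show "A * (C * x) + r1 * (r4 * x + r2 * y) + r2 * (r3 * x + r1 * y) = 0"
        unfolding A by (simp add: algebra_simps)
      show "A * (C * y) + r3 * (r4 * x + r2 * y) + r4 * (r3 * x + r1 * y) = 0"
        unfolding A by (simp add: algebra_simps)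
      show "k1 * (r4 * x + r2 * y) + k2 * (r3 * x + r1 * y) + k3 * (C * x) + k4 * (C * y) = 0"
        using xy(2) by (simp add: algebra_simps)
    qed (use 2 xy in \<open>auto simp: algebra_simps\<close>)
  next
    case 3
    \<comment> \<open>The system splits into \<open>R\<close> and \<open>adj R\<close>, both
      singular; each contributes a kernel vector.\<close>
    then have d: "r1 * r4 = r2 * r3" using det by (simp add: add_eq_0_iff_eq)
    have "\<exists>x y. (x \<noteq> 0 \<or> y \<noteq> 0) \<and> r1 * x + r2 * y = 0 \<and> r3 * x + r4 * y = 0"
    proof (cases "r1 = 0 \<and> r2 = 0")
      case True then show ?thesis using lin[of r3 r4] by auto
    next
      case False
      then show ?thesis using d by - (rule exI[of _ r2], rule exI[of _ r1], auto simp: mult.commute)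
    qed
    then obtain x y where xy: "x \<noteq> 0 \<or> y \<noteq> 0" "r1 * x + r2 * y = 0" "r3 * x + r4 * y = 0" by blast
    have "\<exists>z w. (z \<noteq> 0 \<or> w \<noteq> 0) \<and> r4 * z + r2 * w = 0 \<and> r3 * z + r1 * w = 0"
    proof (cases "r4 = 0 \<and> r2 = 0")
      case True then show ?thesis using lin[of r3 r1] by auto
    next
      case False
      then show ?thesis using d by - (rule exI[of _ r2], rule exI[of _ r4], auto simp: mult.commute)
    qed
    then obtain z w where zw: "z \<noteq> 0 \<or> w \<noteq> 0" "r4 * z + r2 * w = 0" "r3 * z + r1 * w = 0" by blast
    obtain l m where lm: "l \<noteq> 0 \<or> m \<noteq> 0" "(k1 * x + k2 * y) * l + (k3 * z + k4 * w) * m = 0"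
      using lin by blast
    show ?thesis
    proof (rule that[of "l * x" "l * y" "m * z" "m * w"])
      show "l * x \<noteq> 0 \<or> l * y \<noteq> 0 \<or> m * z \<noteq> 0 \<or> m * w \<noteq> 0" using lm xy zw by auto
      have "r1 * (l * x) + r2 * (l * y) = l * (r1 * x + r2 * y)" "r3 * (l * x) + r4 * (l * y) = l * (r3 * x + r4 * y)"
        "r4 * (m * z) + r2 * (m * w) = m * (r4 * z + r2 * w)" "r3 * (m * z) + r1 * (m * w) = m * (r3 * z + r1 * w)"
        by (simp_all add: algebra_simps)
      then show "A * (m * z) + r1 * (l * x) + r2 * (l * y) = 0" "A * (m * w) + r3 * (l * x) + r4 * (l * y) = 0"
        "r4 * (m * z) + r2 * (m * w) + C * (l * x) = 0" "r3 * (m * z) + r1 * (m * w) + C * (l * y) = 0"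
        using 3 xy zw by simp_all
      show "k1 * (l * x) + k2 * (l * y) + k3 * (m * z) + k4 * (m * w) = 0"
        using lm(2) by (simp add: algebra_simps)
    qed
  qed
qed

end

section \<open>Quadratic spaces over finite fields\<close>

context vector_space
begin

lemma card_span_independent:
  assumes "finite B" and "independent B"
  shows "card (span B) = card (UNIV :: 'a set) ^ card B"
  using assms
proof (induction B rule: finite_induct)
  case empty
  then show ?case by simp
next
  case (insert b B)
  then have b: "b \<notin> span B" and B: "independent B" by (auto simp: independent_insert)
  have "span (insert b B) = (\<lambda>(c, x). c *s b + x) ` (UNIV \<times> span B)"
  proof (intro set_eqI iffI)
    fix x assume "x \<in> span (insert b B)"
    then obtain k where "x - k *s b \<in> span B" by (auto simp: span_insert)
    then show "x \<in> (\<lambda>(c, x). c *s b + x) ` (UNIV \<times> span B)"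
      by (intro image_eqI[of _ _ "(k, x - k *s b)"]) auto
  next
    fix x assume "x \<in> (\<lambda>(c, x). c *s b + x) ` (UNIV \<times> span B)"
    then obtain k y where "x = k *s b + y" "y \<in> span B" by auto
    then have "x - k *s b \<in> span B" by simp
    then show "x \<in> span (insert b B)" by (auto simp: span_insert)
  qed
  moreover have "inj_on (\<lambda>(c, x). c *s b + x) (UNIV \<times> span B)"
  proof (rule inj_onI, clarsimp)
    fix c x c' x' assume x: "x \<in> span B" "x' \<in> span B" and eq: "c *s b + x = c' *s b + x'"
    have "(c - c') *s b = x' - x" using eq by (simp add: scale_left_diff_distrib algebra_simps)
    then have "(c - c') *s b \<in> span B" using x by (simp add: span_diff)
    then have "inverse (c - c') *s ((c - c') *s b) \<in> span B" by (rule span_scale)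
    then have "c = c'" using b by (cases "c = c'") auto
    with eq show "c = c' \<and> x = x'" by simp
  qed
  ultimately show ?case using insert B by (simp add: card_image card_cartesian_product)
qed

lemma card_subspace:
  assumes "subspace W" and "finite W"
  shows "card W = card (UNIV :: 'a set) ^ dim W"
proof -
  obtain B where B: "B \<subseteq> W" "independent B" "W \<subseteq> span B" "card B = dim W"
    by (rule basis_exists)
  have "span B = W" using B assms span_minimal by blast
  moreover have "finite B" using B assms finite_subset by blast
  ultimately show ?thesis using B card_span_independent by metis
qed

end

context quadratic_space
begin

lemma polar_commute: "polar Q u v = polar Q v u"
  by (simp add: polar_def add.commute)

lemma Q_add: "Q (u + v) = Q u + Q v + polar Q u v"
  by (simp add: polar_def)

lemma polar_add_right: "polar Q u (v + w) = polar Q u v + polar Q u w"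
  using polar_linear[of u] by (simp add: Vector_Spaces.linear_iff)

lemma polar_scale_right: "polar Q u (a *s v) = a * polar Q u v"
  using polar_linear[of u] by (simp add: Vector_Spaces.linear_iff)

lemma polar_scale_left: "polar Q (a *s u) v = a * polar Q u v"
  by (metis polar_scale_right polar_commute)

lemma polar_minus_right: "polar Q u (- v) = - polar Q u v"
  using polar_scale_right[of u "-1" v] by simp

lemma polar_diff_right: "polar Q u (v - w) = polar Q u v - polar Q u w"
  by (metis polar_add_right polar_minus_right diff_conv_add_uminus)

lemma polar_diff_left: "polar Q (u - v) w = polar Q u w - polar Q v w"
  by (metis polar_diff_right polar_commute)

lemma polar_0_right [simp]: "polar Q u 0 = 0"
  using polar_scale_right[of u 0 0] by simp

lemma Q_0 [simp]: "Q 0 = 0"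
  using Q_scale[of 0 0] by simp

lemma polar_sum_right: "polar Q u (\<Sum>i\<in>I. g i) = (\<Sum>i\<in>I. polar Q u (g i))"
  by (induction I rule: infinite_finite_induct) (simp_all add: polar_add_right)

lemma polar_sum_left: "polar Q (\<Sum>i\<in>I. g i) u = (\<Sum>i\<in>I. polar Q (g i) u)"
  by (simp add: polar_commute[of _ u] polar_sum_right)

lemma totally_singular_imp_totally_isotropic: "totally_singular W \<Longrightarrow> totally_isotropic W"
  by (simp add: totally_singular_def totally_isotropic_def polar_def subspace_add)

lemma totally_singular_Q: "totally_singular W \<Longrightarrow> v \<in> W \<Longrightarrow> Q v = 0"
  by (simp add: totally_singular_def)

lemma totally_singular_polar: "totally_singular W \<Longrightarrow> u \<in> W \<Longrightarrow> v \<in> W \<Longrightarrow> polar Q u v = 0"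
  using totally_singular_imp_totally_isotropic by (simp add: totally_isotropic_def)

lemma Q_sum_eq_0:
  assumes "\<And>i. i \<in> I \<Longrightarrow> Q (f i) = 0" and "\<And>i j. i \<in> I \<Longrightarrow> j \<in> I \<Longrightarrow> polar Q (f i) (f j) = 0"
  shows "Q (\<Sum>i\<in>I. a i *s f i) = 0"
  using assms
  by (induction I rule: infinite_finite_induct)
     (simp_all add: Q_add Q_scale polar_sum_right polar_scale_left polar_scale_right)

end

section \<open>Hyperbolic bases and coordinates\<close>

context O_plus_8_space
begin

text \<open>A Gram-Schmidt induction: correct a new vector of \<open>W\<close> to be orthogonal to
  the earlier \<open>f i\<close>. It is singular and nonzero, so nondegeneracy supplies a partner,
  which is corrected in turn and made singular by subtracting \<open>Q w *s e'\<close>.\<close>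

lemma hyperbolic_pairs:
  assumes W: "totally_singular W" and "n \<le> dim W"
  shows "\<exists>e f. (\<forall>i<n. e i \<in> W \<and> Q (f i) = 0) \<and>
    (\<forall>i<n. \<forall>j<n. polar Q (e i) (f j) = (if i = j then 1 else 0) \<and> polar Q (f i) (f j) = 0)"
  using assms(2)
proof (induction n)
  case 0
  then show ?case by simp
next
  case (Suc n)
  then obtain e f where *: "\<forall>i<n. e i \<in> W \<and> Q (f i) = 0"
    "\<forall>i<n. \<forall>j<n. polar Q (e i) (f j) = (if i = j then 1 else 0) \<and> polar Q (f i) (f j) = 0"
    by auto
  then have eW: "\<And>i. i < n \<Longrightarrow> e i \<in> W" and f: "\<And>i. i < n \<Longrightarrow> Q (f i) = 0"
    and ef: "\<And>i j. i < n \<Longrightarrow> j < n \<Longrightarrow> polar Q (e i) (f j) = (if i = j then 1 else 0)"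
    and ff: "\<And>i j. i < n \<Longrightarrow> j < n \<Longrightarrow> polar Q (f i) (f j) = 0"
    by simp_all
  have subW: "subspace W" using W by (simp add: totally_singular_def)
  have ee: "polar Q (e i) (e j) = 0" if "i < n" "j < n" for i j
    using W that by (auto intro: totally_singular_polar eW)
  have fe: "polar Q (f i) (e j) = (if i = j then 1 else 0)" if "i < n" "j < n" for i j
    using ef[OF that(2,1)] by (auto simp: polar_commute)
  have "\<not> W \<subseteq> span (e ` {..<n})"
  proof
    assume "W \<subseteq> span (e ` {..<n})"
    then have "dim W \<le> card (e ` {..<n})" by (rule dim_le_card) simp
    also have "\<dots> \<le> n" using card_image_le[of "{..<n}" e] by simp
    finally show False using Suc.prems by simp
  qed
  then obtain x where x: "x \<in> W" "x \<notin> span (e ` {..<n})" by blast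
  define e' where "e' = x - (\<Sum>i<n. polar Q x (f i) *s e i)"
  have e'W: "e' \<in> W" unfolding e'_def
    by (intro subspace_diff subspace_sum subspace_scale subW x eW) auto
  have "(\<Sum>i<n. polar Q x (f i) *s e i) \<in> span (e ` {..<n})"
    by (intro span_sum span_scale span_base) auto
  then have "e' \<noteq> 0" using x(2) by (auto simp: e'_def)
  then obtain v where v: "polar Q e' v \<noteq> 0"
    using nondegenerate[of e'] totally_singular_Q[OF W e'W] by blast
  have e'f: "polar Q e' (f i) = 0" if "i < n" for i
    using that by (simp add: e'_def polar_diff_left polar_sum_left polar_scale_left ef if_distrib cong: if_cong)
  have e'e: "polar Q e' (e i) = 0" if "i < n" for i
    using W that by (auto intro: totally_singular_polar eW e'W)
  define v' where "v' = v - (\<Sum>i<n. polar Q (e i) v *s f i) - (\<Sum>i<n. polar Q (f i) v *s e i)"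
  have ev': "polar Q (e i) v' = 0" if "i < n" for i
    using that by (simp add: v'_def polar_diff_right polar_sum_right polar_scale_right ef ee if_distrib cong: if_cong)
  have fv': "polar Q (f i) v' = 0" if "i < n" for i
    using that by (simp add: v'_def polar_diff_right polar_sum_right polar_scale_right fe ff if_distrib cong: if_cong)
  have e'v': "polar Q e' v' = polar Q e' v"
    by (simp add: v'_def polar_diff_right polar_sum_right polar_scale_right e'e e'f)
  define w where "w = (1 / polar Q e' v) *s v'"
  have e'w: "polar Q e' w = 1" using v by (simp add: w_def polar_scale_right e'v')
  define f' where "f' = w - Q w *s e'"
  have e'e': "polar Q e' e' = 0" using W e'W by (blast intro: totally_singular_polar)
  have 1: "polar Q e' f' = 1" by (simp add: f'_def polar_diff_right polar_scale_right e'w e'e')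
  have 2: "polar Q (e i) f' = 0" "polar Q (f i) f' = 0" if "i < n" for i
    using that e'e[OF that] e'f[OF that]
    by (simp_all add: f'_def w_def polar_diff_right polar_scale_right ev' fv' polar_commute[of _ e'])
  have "Q w = Q (f' + Q w *s e')" by (simp add: f'_def)
  also have "\<dots> = Q f' + Q w"
    using 1 by (simp add: Q_add Q_scale polar_scale_right polar_commute[of f'] totally_singular_Q[OF W e'W])
  finally have 3: "Q f' = 0" by simp
  have 4: "polar Q f' f' = 0"
    \<comment> \<open>Since \<open>polar Q f' f' = Q (f' + f') - 2 * Q f'\<close>, singularity
      suffices in every characteristic.\<close>
    using Q_scale[of 2 f'] 3 by (simp add: polar_def scale_left_distrib[of 1 1, simplified])
  have 5: "polar Q f' (f i) = 0" if "i < n" for i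
    using 2(2)[OF that] by (simp only: polar_commute[of f'])
  show ?case
  proof (rule exI[of _ "e(n := e')"], rule exI[of _ "f(n := f')"], intro conjI allI impI)
    fix i j assume "i < Suc n" "j < Suc n"
    then show "polar Q ((e(n := e')) i) ((f(n := f')) j) = (if i = j then 1 else 0)"
      "polar Q ((f(n := f')) i) ((f(n := f')) j) = 0"
      using 1 2 4 5 e'f by (auto simp: less_Suc_eq ef ff)
  qed (use 3 f eW e'W in \<open>auto simp: less_Suc_eq\<close>)
qed

lemma card_UNIV_field_power_8:
  "card (UNIV :: 'v set) = card (UNIV :: 'a set) ^ 8"
proof -
  obtain B where B: "independent B" "(UNIV :: 'v set) \<subseteq> span B" "card B = 8"
    using basis_exists[of UNIV] dim_8 by metis
  then have "finite B" by (metis card.infinite zero_neq_numeral)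
  then have "card (span B) = card (UNIV :: 'a set) ^ 8" using B card_span_independent by metis
  moreover have "span B = UNIV" using B by blast
  ultimately show ?thesis by simp
qed

end

text \<open>
  Each of the pairs \<open>(A\<^sub>1, A\<^sub>2)\<close>, \<open>(B\<^sub>1, B\<^sub>2)\<close>, \<open>(C\<^sub>1, C\<^sub>2)\<close>, \<open>(D\<^sub>1, D\<^sub>2)\<close> takes values in \<open>V\<^sub>2 = F\<^sup>2\<close>. In
  characteristic 2 the form \<open>Q\<close> is \<open>[A, C] + [B, D]\<close> for the determinant form on \<open>V\<^sub>2\<close>.
\<close>

locale split_coordinates = quadratic_space scale Q
  for scale :: "'a::{field,finite} \<Rightarrow> 'v::ab_group_add \<Rightarrow> 'v" (infixr "*s" 75) and Q +
  fixes A\<^sub>1 A\<^sub>2 B\<^sub>1 B\<^sub>2 C\<^sub>1 C\<^sub>2 D\<^sub>1 D\<^sub>2 :: "'v \<Rightarrow> 'a"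
  assumes coord_linear: "h \<in> {A\<^sub>1, A\<^sub>2, B\<^sub>1, B\<^sub>2, C\<^sub>1, C\<^sub>2, D\<^sub>1, D\<^sub>2} \<Longrightarrow> Vector_Spaces.linear scale (*) h"
    and Q_coord: "Q v = A\<^sub>1 v * C\<^sub>2 v + A\<^sub>2 v * C\<^sub>1 v + B\<^sub>1 v * D\<^sub>2 v + B\<^sub>2 v * D\<^sub>1 v"
    and bij_coord: "bij (\<lambda>v. (A\<^sub>1 v, A\<^sub>2 v, B\<^sub>1 v, B\<^sub>2 v, C\<^sub>1 v, C\<^sub>2 v, D\<^sub>1 v, D\<^sub>2 v))"

text \<open>Plus type gives a totally singular 4-space, hence four hyperbolic pairs; the coordinates
  of a vector are its polar values with them.\<close>

lemma split_coordinates_exist: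
  fixes scale :: "'a::{field,finite} \<Rightarrow> 'v::ab_group_add \<Rightarrow> 'v"
  assumes "O_plus_8_space scale Q"
  shows "\<exists>A\<^sub>1 A\<^sub>2 B\<^sub>1 B\<^sub>2 C\<^sub>1 C\<^sub>2 D\<^sub>1 D\<^sub>2. split_coordinates scale Q A\<^sub>1 A\<^sub>2 B\<^sub>1 B\<^sub>2 C\<^sub>1 C\<^sub>2 D\<^sub>1 D\<^sub>2"
proof -
  interpret O_plus_8_space scale Q by (rule assms)
  have card: "card (UNIV :: 'v set) = card (UNIV :: 'a set) ^ 8" by (rule card_UNIV_field_power_8)
  then have finV: "finite (UNIV :: 'v set)" by (metis card_gt_0_iff finite empty_not_UNIV zero_less_power)
  then have "finite (Collect totally_singular)" by (metis finite_Collect_subsets finite_subset subset_UNIV Finite_Set.finite_set)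
  then have "finite {dim W | W. totally_singular W}" by (simp add: setcompr_eq_image)
  moreover have "totally_singular {0}" by (simp add: totally_singular_def)
  ultimately have "witt_index \<in> {dim W | W. totally_singular W}"
    unfolding witt_index_def by (intro Max_in) auto
  then obtain W where W: "totally_singular W" "dim W = 4" using plus_type by auto
  then obtain e f :: "nat \<Rightarrow> 'v" where *: "\<forall>i<4. e i \<in> W \<and> Q (f i) = 0"
    "\<forall>i<4. \<forall>j<4. polar Q (e i) (f j) = (if i = j then 1 else 0) \<and> polar Q (f i) (f j) = 0"
    using hyperbolic_pairs[OF W(1), of 4] by auto
  then have eW: "\<And>i. i < 4 \<Longrightarrow> e i \<in> W" and f: "\<And>i. i < 4 \<Longrightarrow> Q (f i) = 0"
    and ef: "\<And>i j. i < 4 \<Longrightarrow> j < 4 \<Longrightarrow> polar Q (e i) (f j) = (if i = j then 1 else 0)"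
    and ff: "\<And>i j. i < 4 \<Longrightarrow> j < 4 \<Longrightarrow> polar Q (f i) (f j) = 0"
    by simp_all
  have subW: "subspace W" using W by (simp add: totally_singular_def)
  have ee: "polar Q (e i) (e j) = 0" if "i < 4" "j < 4" for i j
    using W that by (auto intro: totally_singular_polar eW)
  have fe: "polar Q (f i) (e j) = (if i = j then 1 else 0)" if "i < 4" "j < 4" for i j
    using ef[OF that(2,1)] by (auto simp: polar_commute)
  define g where "g a b = (\<Sum>i<4. scale (a i) (e i)) + (\<Sum>i<4. scale (b i) (f i))" for a b :: "nat \<Rightarrow> 'a"
  have xg: "polar Q (f i) (g a b) = a i" and yg: "polar Q (e i) (g a b) = b i" if "i < 4" for i a b
    using that by (simp_all add: g_def polar_add_right polar_sum_right polar_scale_right ee ef fe ff if_distrib cong: if_cong)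
  have Qg: "Q (g a b) = (\<Sum>i<4. a i * b i)" for a b
  proof -
    have "Q (\<Sum>i<4. scale (a i) (e i)) = 0"
      by (rule Q_sum_eq_0) (simp_all add: totally_singular_Q[OF W(1) eW] ee)
    moreover have "Q (\<Sum>i<4. scale (b i) (f i)) = 0"
      by (rule Q_sum_eq_0) (simp_all add: f ff)
    ultimately show ?thesis
      by (simp add: g_def Q_add polar_sum_left polar_sum_right polar_scale_left polar_scale_right ef if_distrib mult.commute cong: if_cong)
  qed
  define P where "P v = (polar Q (f 0) v, polar Q (f 1) v, polar Q (f 2) v, polar Q (f 3) v,
    polar Q (e 1) v, polar Q (e 0) v, polar Q (e 3) v, polar Q (e 2) v)" for v
  have "surj P"
  proof (rule surjI)
    fix t
    show "P ((\<lambda>(a0, a1, a2, a3, b1, b0, b3, b2). g ((!) [a0, a1, a2, a3]) ((!) [b0, b1, b2, b3])) t) = t"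
      by (simp add: P_def xg yg split: prod.split)
  qed
  \<comment> \<open>Equal cardinalities turn surjectivity into injectivity, so the hyperbolic pairs
    span.\<close>
  moreover have "card (UNIV :: ('a \<times> 'a \<times> 'a \<times> 'a \<times> 'a \<times> 'a \<times> 'a \<times> 'a) set) = card (UNIV :: 'v set)"
    unfolding card by (simp add: card_cartesian_product eval_nat_numeral flip: UNIV_Times_UNIV)
  ultimately have inj: "inj P" by (intro eq_card_imp_inj_on finV) simp
  have Q: "Q v = polar Q (f 0) v * polar Q (e 0) v + polar Q (f 1) v * polar Q (e 1) v
     + polar Q (f 2) v * polar Q (e 2) v + polar Q (f 3) v * polar Q (e 3) v" for v
  proof -
    have "v = g (\<lambda>i. polar Q (f i) v) (\<lambda>i. polar Q (e i) v)"
      by (rule injD[OF inj]) (simp add: P_def xg yg)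
    then have "Q v = (\<Sum>i<4. polar Q (f i) v * polar Q (e i) v)" using Qg by metis
    then show ?thesis by (simp add: eval_nat_numeral)
  qed
  have "bij P" using inj \<open>surj P\<close> by (simp add: bij_def)
  \<comment> \<open>The \<open>e\<close> are swapped within each pair because
    \<open>A\<^sub>1\<close> is paired with \<open>C\<^sub>2\<close> and \<open>A\<^sub>2\<close>
    with \<open>C\<^sub>1\<close>.\<close>
  then have "split_coordinates scale Q (polar Q (f 0)) (polar Q (f 1)) (polar Q (f 2)) (polar Q (f 3))
    (polar Q (e 1)) (polar Q (e 0)) (polar Q (e 3)) (polar Q (e 2))"
    by (intro split_coordinates.intro split_coordinates_axioms.intro quadratic_space_axioms)
       (blast intro: polar_linear, rule Q, simp add: P_def[abs_def])
  then show ?thesis by blast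
qed

section \<open>The partial spread\<close>

locale suzuki_tits_coordinates = tits_endomorphism \<sigma> + split_coordinates scale Q A\<^sub>1 A\<^sub>2 B\<^sub>1 B\<^sub>2 C\<^sub>1 C\<^sub>2 D\<^sub>1 D\<^sub>2
  for \<sigma> :: "'a::{field,finite} \<Rightarrow> 'a"
    and scale :: "'a \<Rightarrow> 'v::ab_group_add \<Rightarrow> 'v" (infixr "*s" 75)
    and Q A\<^sub>1 A\<^sub>2 B\<^sub>1 B\<^sub>2 C\<^sub>1 C\<^sub>2 D\<^sub>1 D\<^sub>2
begin

lemma coord_add [simp]:
  "A\<^sub>1 (u + v) = A\<^sub>1 u + A\<^sub>1 v" "A\<^sub>2 (u + v) = A\<^sub>2 u + A\<^sub>2 v"
  "B\<^sub>1 (u + v) = B\<^sub>1 u + B\<^sub>1 v" "B\<^sub>2 (u + v) = B\<^sub>2 u + B\<^sub>2 v"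
  "C\<^sub>1 (u + v) = C\<^sub>1 u + C\<^sub>1 v" "C\<^sub>2 (u + v) = C\<^sub>2 u + C\<^sub>2 v"
  "D\<^sub>1 (u + v) = D\<^sub>1 u + D\<^sub>1 v" "D\<^sub>2 (u + v) = D\<^sub>2 u + D\<^sub>2 v"
  using coord_linear by (simp_all add: Vector_Spaces.linear_iff)

lemma coord_scale [simp]:
  "A\<^sub>1 (a *s v) = a * A\<^sub>1 v" "A\<^sub>2 (a *s v) = a * A\<^sub>2 v"
  "B\<^sub>1 (a *s v) = a * B\<^sub>1 v" "B\<^sub>2 (a *s v) = a * B\<^sub>2 v"
  "C\<^sub>1 (a *s v) = a * C\<^sub>1 v" "C\<^sub>2 (a *s v) = a * C\<^sub>2 v"
  "D\<^sub>1 (a *s v) = a * D\<^sub>1 v" "D\<^sub>2 (a *s v) = a * D\<^sub>2 v"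
  using coord_linear by (simp_all add: Vector_Spaces.linear_iff)

lemma coord_0 [simp]:
  "A\<^sub>1 0 = 0" "A\<^sub>2 0 = 0" "B\<^sub>1 0 = 0" "B\<^sub>2 0 = 0" "C\<^sub>1 0 = 0" "C\<^sub>2 0 = 0" "D\<^sub>1 0 = 0" "D\<^sub>2 0 = 0"
  using coord_scale[of 0 0] by simp_all

lemma coord_eqI:
  assumes "A\<^sub>1 u = A\<^sub>1 v" "A\<^sub>2 u = A\<^sub>2 v" "B\<^sub>1 u = B\<^sub>1 v" "B\<^sub>2 u = B\<^sub>2 v"
    "C\<^sub>1 u = C\<^sub>1 v" "C\<^sub>2 u = C\<^sub>2 v" "D\<^sub>1 u = D\<^sub>1 v" "D\<^sub>2 u = D\<^sub>2 v"
  shows "u = v"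
  using bij_coord assms by (auto simp: bij_def inj_def)

lemma coord_surj:
  obtains v where "A\<^sub>1 v = a1" "A\<^sub>2 v = a2" "B\<^sub>1 v = b1" "B\<^sub>2 v = b2"
    "C\<^sub>1 v = c1" "C\<^sub>2 v = c2" "D\<^sub>1 v = d1" "D\<^sub>2 v = d2"
proof -
  have "surj (\<lambda>v. (A\<^sub>1 v, A\<^sub>2 v, B\<^sub>1 v, B\<^sub>2 v, C\<^sub>1 v, C\<^sub>2 v, D\<^sub>1 v, D\<^sub>2 v))"
    using bij_coord by (rule bij_is_surj)
  then obtain v where "(a1, a2, b1, b2, c1, c2, d1, d2) = (A\<^sub>1 v, A\<^sub>2 v, B\<^sub>1 v, B\<^sub>2 v, C\<^sub>1 v, C\<^sub>2 v, D\<^sub>1 v, D\<^sub>2 v)"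
    by (rule surjE)
  then show ?thesis using that by simp
qed

lemma polar_coord:
  "polar Q u v = A\<^sub>1 u * C\<^sub>2 v + A\<^sub>1 v * C\<^sub>2 u + A\<^sub>2 u * C\<^sub>1 v + A\<^sub>2 v * C\<^sub>1 u
    + B\<^sub>1 u * D\<^sub>2 v + B\<^sub>1 v * D\<^sub>2 u + B\<^sub>2 u * D\<^sub>1 v + B\<^sub>2 v * D\<^sub>1 u"
  by (simp add: polar_def Q_coord algebra_simps)

lemma finite_vectors: "finite (UNIV :: 'v set)"
  using bij_betw_finite[OF bij_coord] by simp

lemma card_quadruples: "card (UNIV :: ('a \<times> 'a \<times> 'a \<times> 'a) set) = card (UNIV :: 'a set) ^ 4"
  by (simp add: card_cartesian_product eval_nat_numeral flip: UNIV_Times_UNIV)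

lemma dim_eq_4_iff:
  assumes "subspace W"
  shows "dim W = 4 \<longleftrightarrow> card W = card (UNIV :: ('a \<times> 'a \<times> 'a \<times> 'a) set)"
proof -
  have "finite W" using finite_vectors by (rule finite_subset[rotated]) simp
  with card_gt_4 show ?thesis by (simp add: card_subspace assms card_quadruples)
qed

text \<open>
  \<open>M\<^sub>0\<close> is \<open>L\<^sub>0 \<otimes> V\<^sub>2\<close>. The spread lines meeting \<open>L\<^sub>0\<close> are the one at infinity and those with
  \<open>a = 0\<close>, whence the restriction \<open>a \<noteq> 0\<close>.
\<close>

definition M\<^sub>0 :: "'v set" where
  "M\<^sub>0 = {v. B\<^sub>1 v = 0 \<and> B\<^sub>2 v = 0 \<and> C\<^sub>1 v = 0 \<and> C\<^sub>2 v = 0}"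

definition M :: "'a \<Rightarrow> 'a \<Rightarrow> 'v set" where
  "M a b = {v. C\<^sub>1 v = a * A\<^sub>1 v + b * B\<^sub>1 v \<and> C\<^sub>2 v = a * A\<^sub>2 v + b * B\<^sub>2 v \<and>
     D\<^sub>1 v = b * A\<^sub>1 v + \<delta> a b * B\<^sub>1 v \<and> D\<^sub>2 v = b * A\<^sub>2 v + \<delta> a b * B\<^sub>2 v}"

definition S :: "'v set set" where
  "S = insert M\<^sub>0 ((\<lambda>(a, b). M a b) ` ((UNIV - {0}) \<times> UNIV))"

lemma totally_singular_M\<^sub>0: "totally_singular M\<^sub>0"
  by (auto simp: totally_singular_def subspace_def M\<^sub>0_def Q_coord)

text \<open>The matrix is symmetric, so \<open>Q\<close> reduces to
  \<open>b * [A, B] + b * [B, A] = 0\<close>.\<close>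

lemma totally_singular_M: "totally_singular (M a b)"
  by (auto simp: totally_singular_def subspace_def M_def Q_coord algebra_simps)

lemma dim_M\<^sub>0: "dim M\<^sub>0 = 4"
proof -
  have "bij_betw (\<lambda>v. (A\<^sub>1 v, A\<^sub>2 v, D\<^sub>1 v, D\<^sub>2 v)) M\<^sub>0 UNIV"
  proof (intro bij_betw_imageI inj_onI)
    fix u v assume "u \<in> M\<^sub>0" "v \<in> M\<^sub>0" "(A\<^sub>1 u, A\<^sub>2 u, D\<^sub>1 u, D\<^sub>2 u) = (A\<^sub>1 v, A\<^sub>2 v, D\<^sub>1 v, D\<^sub>2 v)"
    then show "u = v" by (auto simp: M\<^sub>0_def intro: coord_eqI)
  next
    have "t \<in> (\<lambda>v. (A\<^sub>1 v, A\<^sub>2 v, D\<^sub>1 v, D\<^sub>2 v)) ` M\<^sub>0" for t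
    proof -
      obtain a1 a2 d1 d2 where t: "t = (a1, a2, d1, d2)" by (cases t)
      obtain v where "A\<^sub>1 v = a1" "A\<^sub>2 v = a2" "B\<^sub>1 v = 0" "B\<^sub>2 v = 0"
        "C\<^sub>1 v = 0" "C\<^sub>2 v = 0" "D\<^sub>1 v = d1" "D\<^sub>2 v = d2" by (rule coord_surj)
      then show ?thesis by (intro image_eqI[of _ _ v]) (auto simp: t M\<^sub>0_def)
    qed
    then show "(\<lambda>v. (A\<^sub>1 v, A\<^sub>2 v, D\<^sub>1 v, D\<^sub>2 v)) ` M\<^sub>0 = UNIV" by blast
  qed
  then show ?thesis
    using totally_singular_M\<^sub>0 by (simp add: totally_singular_def dim_eq_4_iff bij_betw_same_card)
qed

lemma dim_M: "dim (M a b) = 4"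
proof -
  have "bij_betw (\<lambda>v. (A\<^sub>1 v, A\<^sub>2 v, B\<^sub>1 v, B\<^sub>2 v)) (M a b) UNIV"
  proof (intro bij_betw_imageI inj_onI)
    fix u v assume "u \<in> M a b" "v \<in> M a b" "(A\<^sub>1 u, A\<^sub>2 u, B\<^sub>1 u, B\<^sub>2 u) = (A\<^sub>1 v, A\<^sub>2 v, B\<^sub>1 v, B\<^sub>2 v)"
    then show "u = v" by (auto simp: M_def intro: coord_eqI)
  next
    have "t \<in> (\<lambda>v. (A\<^sub>1 v, A\<^sub>2 v, B\<^sub>1 v, B\<^sub>2 v)) ` M a b" for t
    proof -
      obtain a1 a2 b1 b2 where t: "t = (a1, a2, b1, b2)" by (cases t)
      obtain v where "A\<^sub>1 v = a1" "A\<^sub>2 v = a2" "B\<^sub>1 v = b1" "B\<^sub>2 v = b2"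
        "C\<^sub>1 v = a * a1 + b * b1" "C\<^sub>2 v = a * a2 + b * b2"
        "D\<^sub>1 v = b * a1 + \<delta> a b * b1" "D\<^sub>2 v = b * a2 + \<delta> a b * b2" by (rule coord_surj)
      then show ?thesis by (intro image_eqI[of _ _ v]) (auto simp: t M_def)
    qed
    then show "(\<lambda>v. (A\<^sub>1 v, A\<^sub>2 v, B\<^sub>1 v, B\<^sub>2 v)) ` M a b = UNIV" by blast
  qed
  then show ?thesis
    using totally_singular_M by (simp add: totally_singular_def dim_eq_4_iff bij_betw_same_card)
qed

lemma M\<^sub>0_Int_M:
  assumes "a \<noteq> 0" shows "M\<^sub>0 \<inter> M a b = {0}"
  using assms by (auto simp: M\<^sub>0_def M_def intro!: coord_eqI)

lemma M_Int_M:
  assumes ne: "(a, b) \<noteq> (a', b')"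
  shows "M a b \<inter> M a' b' = {0}"
proof -
  have det: "x = 0 \<and> y = 0"
    if "a * x + b * y = a' * x + b' * y" "b * x + \<delta> a b * y = b' * x + \<delta> a' b' * y" for x y
  proof -
    define k l m where "k = a + a'" and "l = b + b'" and "m = \<delta> a b + \<delta> a' b'"
    note klm = this
    have "k * m \<noteq> l\<^sup>2" using det_difference_eq_0[of a a' b b'] ne by (auto simp: klm)
    then have km: "k * m + l * l \<noteq> 0" by (simp add: add_eq_0_iff_eq power2_eq_square)
    have "(a * x + b * y) + (a' * x + b' * y) = 0"
      "(b * x + \<delta> a b * y) + (b' * x + \<delta> a' b' * y) = 0" by (simp_all add: that)
    then have 1: "k * x + l * y = 0" and 2: "l * x + m * y = 0"
      by (simp_all add: klm algebra_simps)
    \<comment> \<open>This multiplies by the adjugate of the difference of the two matrices.\<close>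
    have *: "(k * m + l * l) * x = m * (k * x + l * y) + l * (l * x + m * y)"
      "(k * m + l * l) * y = l * (k * x + l * y) + k * (l * x + m * y)"
      by (simp_all add: algebra_simps)
    have "(k * m + l * l) * x = 0" "(k * m + l * l) * y = 0"
      unfolding * 1 2 by simp_all
    then show ?thesis using km by simp
  qed
  have "v = 0" if "v \<in> M a b" "v \<in> M a' b'" for v
  proof (rule coord_eqI)
    have "A\<^sub>1 v = 0 \<and> B\<^sub>1 v = 0" "A\<^sub>2 v = 0 \<and> B\<^sub>2 v = 0"
      by (rule det; use that in \<open>simp add: M_def\<close>)+
    then show "A\<^sub>1 v = A\<^sub>1 0" "A\<^sub>2 v = A\<^sub>2 0" "B\<^sub>1 v = B\<^sub>1 0" "B\<^sub>2 v = B\<^sub>2 0"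
      "C\<^sub>1 v = C\<^sub>1 0" "C\<^sub>2 v = C\<^sub>2 0" "D\<^sub>1 v = D\<^sub>1 0" "D\<^sub>2 v = D\<^sub>2 0"
      using that by (simp_all add: M_def)
  qed
  moreover have "0 \<in> M a b \<inter> M a' b'" by (simp add: M_def)
  ultimately show ?thesis by blast
qed

lemma orthogonal_partial_spread_S: "orthogonal_partial_spread S"
  unfolding orthogonal_partial_spread_def
proof (intro conjI ballI impI)
  fix W assume "W \<in> S"
  then show "totally_singular W" "dim W = 4"
    by (auto simp: S_def totally_singular_M\<^sub>0 totally_singular_M dim_M\<^sub>0 dim_M)
next
  fix W X assume WX: "W \<in> S" "X \<in> S" "W \<noteq> X"
  then have "W = M\<^sub>0 \<or> (\<exists>a b. a \<noteq> 0 \<and> W = M a b)" "X = M\<^sub>0 \<or> (\<exists>a b. a \<noteq> 0 \<and> X = M a b)"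
    by (auto simp: S_def)
  with WX consider a b where "W = M\<^sub>0" "X = M a b" "a \<noteq> 0" | a b where "W = M a b" "X = M\<^sub>0" "a \<noteq> 0"
    | a b a' b' where "W = M a b" "X = M a' b'"
    by metis
  then show "W \<inter> X = {0}"
  proof cases
    case 1 then show ?thesis using M\<^sub>0_Int_M by simp
  next
    case 2 then show ?thesis using M\<^sub>0_Int_M by (simp add: Int_commute)
  next
    case 3
    then have "(a, b) \<noteq> (a', b')" using WX by auto
    with 3 show ?thesis using M_Int_M by simp
  qed
qed

text \<open>Equal members with different parameters would coincide with their trivial intersection;
  the count is \<open>(q - 1) * q + 1\<close>.\<close>

lemma card_S: "card S = (card (UNIV :: 'a set))\<^sup>2 - card (UNIV :: 'a set) + 1"
proof -
  have "{0::'v} \<noteq> M a b" "{0::'v} \<noteq> M\<^sub>0" for a b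
    using dim_M[of a b] dim_M\<^sub>0 dim_span[of "{}"] dim_eq_card_independent[OF independent_empty] by auto
  note nontrivial = this
  have nz: "M a b \<noteq> M a' b'" if "(a, b) \<noteq> (a', b')" for a b a' b'
    using M_Int_M[OF that] nontrivial by (metis Int_absorb)
  have nz0: "M\<^sub>0 \<noteq> M a b" if "a \<noteq> 0" for a b
    using M\<^sub>0_Int_M[OF that] nontrivial by (metis Int_absorb)
  let ?P = "(UNIV - {0::'a}) \<times> (UNIV :: 'a set)"
  have "inj_on (\<lambda>(a, b). M a b) ?P" using nz by (auto intro!: inj_onI)
  then have "card ((\<lambda>(a, b). M a b) ` ?P) = card ?P" by (rule card_image)
  also have "\<dots> = (card (UNIV :: 'a set))\<^sup>2 - card (UNIV :: 'a set)"
    by (simp add: card_cartesian_product card_Diff_singleton power2_eq_square diff_mult_distrib)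
  finally show ?thesis
    unfolding S_def using nz0 by (subst card_insert_disjoint) auto
qed

section \<open>Maximality\<close>

lemma totally_isotropic_meets_S:
  assumes W: "totally_isotropic W" and dimW: "dim W = 4"
  shows "\<exists>X\<in>S. W \<inter> X \<noteq> {0}"
proof (cases "W \<inter> M\<^sub>0 = {0}")
  case False
  then show ?thesis by (auto simp: S_def)
next
  case disj: True
  have subW: "subspace W" and iso: "\<And>u v. u \<in> W \<Longrightarrow> v \<in> W \<Longrightarrow> polar Q u v = 0"
    using W by (auto simp: totally_isotropic_def)
  let ?\<pi> = "\<lambda>v. (B\<^sub>1 v, B\<^sub>2 v, C\<^sub>1 v, C\<^sub>2 v)"
  have inj: "inj_on ?\<pi> W"
  proof (rule inj_onI)
    fix u v assume uv: "u \<in> W" "v \<in> W" "?\<pi> u = ?\<pi> v"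
    then have "u + (-1) *s v \<in> W" by (intro subspace_add subspace_scale subW)
    moreover have "u + (-1) *s v \<in> M\<^sub>0" using uv(3) by (simp add: M\<^sub>0_def del: scale_minus_left)
    ultimately have "u + (-1) *s v = 0" using disj by blast
    then show "u = v" by (simp del: uminus_eq)
  qed
  have surj: "?\<pi> ` W = UNIV"
  proof (rule card_subset_eq)
    show "card (?\<pi> ` W) = card (UNIV :: ('a \<times> 'a \<times> 'a \<times> 'a) set)"
      using dimW by (simp add: card_image[OF inj] flip: dim_eq_4_iff[OF subW])
  qed auto
  have ex: "\<exists>m\<in>W. B\<^sub>1 m = b1 \<and> B\<^sub>2 m = b2 \<and> C\<^sub>1 m = c1 \<and> C\<^sub>2 m = c2" for b1 b2 c1 c2
  proof -
    have "(b1, b2, c1, c2) \<in> ?\<pi> ` W" by (simp add: surj)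
    then show ?thesis by auto
  qed
  obtain m1 where m1: "m1 \<in> W" "B\<^sub>1 m1 = 1" "B\<^sub>2 m1 = 0" "C\<^sub>1 m1 = 0" "C\<^sub>2 m1 = 0" using ex by blast
  obtain m2 where m2: "m2 \<in> W" "B\<^sub>1 m2 = 0" "B\<^sub>2 m2 = 1" "C\<^sub>1 m2 = 0" "C\<^sub>2 m2 = 0" using ex by blast
  obtain m3 where m3: "m3 \<in> W" "B\<^sub>1 m3 = 0" "B\<^sub>2 m3 = 0" "C\<^sub>1 m3 = 1" "C\<^sub>2 m3 = 0" using ex by blast
  obtain m4 where m4: "m4 \<in> W" "B\<^sub>1 m4 = 0" "B\<^sub>2 m4 = 0" "C\<^sub>1 m4 = 0" "C\<^sub>2 m4 = 1" using ex by blast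
  note m = m1 m2 m3 m4
  \<comment> \<open>As \<open>W\<close> is totally isotropic, \<open>Q\<close> is additive on it, so
    \<open>Q\<close> is the square of the functional with coefficients \<open>k1\<close>, ...,
    \<open>k4\<close>.\<close>
  obtain k1 where k1: "k1\<^sup>2 = Q m1" using surj_square by blast
  obtain k2 where k2: "k2\<^sup>2 = Q m2" using surj_square by blast
  obtain k3 where k3: "k3\<^sup>2 = Q m3" using surj_square by blast
  obtain k4 where k4: "k4\<^sup>2 = Q m4" using surj_square by blast
  have D2m1: "D\<^sub>2 m1 = k1 * k1" and D1m2: "D\<^sub>1 m2 = k2 * k2" and A2m3: "A\<^sub>2 m3 = k3 * k3"
    and A1m4: "A\<^sub>1 m4 = k4 * k4"
    using k1 k2 k3 k4 m by (simp_all add: Q_coord power2_eq_square)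
  have D2m2: "D\<^sub>2 m2 = D\<^sub>1 m1" and D2m3: "D\<^sub>2 m3 = A\<^sub>2 m1" and D2m4: "D\<^sub>2 m4 = A\<^sub>1 m1"
    and D1m3: "D\<^sub>1 m3 = A\<^sub>2 m2" and D1m4: "D\<^sub>1 m4 = A\<^sub>1 m2" and A2m4: "A\<^sub>2 m4 = A\<^sub>1 m3"
    using iso[of m1 m2] iso[of m1 m3] iso[of m1 m4] iso[of m2 m3] iso[of m2 m4] iso[of m3 m4] m
    by (simp_all add: polar_coord add_eq_0_iff_eq)
  txt \<open>
    On the hyperplane \<open>k1 * c1 + k2 * c2 + k3 * c3 + k4 * c4 = 0\<close> of \<open>W\<close>, where \<open>Q\<close> vanishes, these
    entries describe \<open>W\<close>: there \<open>A = p C + R B\<close> and \<open>D = adj R C + s B\<close>.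
  \<close>
  define p s where "p = A\<^sub>1 m3 + k3 * k4" and "s = D\<^sub>1 m1 + k1 * k2"
  note ps = this
  define r1 r2 r3 r4 where "r1 = A\<^sub>1 m1 + k1 * k4" and "r2 = A\<^sub>1 m2 + k2 * k4"
    and "r3 = A\<^sub>2 m1 + k1 * k3" and "r4 = A\<^sub>2 m2 + k2 * k3"
  note r = this
  \<comment> \<open>This is the Pfaffian condition for meeting \<open>M a b\<close>, multiplied by
    \<open>a\<close> to clear denominators.\<close>
  have "\<exists>a b. a \<noteq> 0 \<and> p * (a * \<delta> a b + b\<^sup>2) + \<delta> a b + (r1 + r4) * b + (p * s + r1 * r4 + r2 * r3) * a + s = 0"
  proof (cases "p = 0")
    case True
    then show ?thesis using section_linear by simp
  next
    case False
    then show ?thesis by (rule section_nonlinear)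
  qed
  then obtain a b where a0: "a \<noteq> 0"
    and ab: "p * (a * \<delta> a b + b\<^sup>2) + \<delta> a b + (r1 + r4) * b + (p * s + r1 * r4 + r2 * r3) * a + s = 0"
    by blast
  txt \<open>Solving the equations of \<open>M a b\<close> for \<open>A\<close> and \<open>D\<close> gives \<open>A = a' C + b' B\<close> and \<open>D = b' C + c' B\<close>.\<close>
  define a' b' c' where "a' = 1 / a" and "b' = b / a" and "c' = \<delta> a b + b\<^sup>2 / a"
  note abc' = this
  have "a * ((p + a') * (s + c') + ((r1 + b') * (r4 + b') + r2 * r3)) = 0"
  proof -
    have aa: "a * a' = 1" and b': "b' = b * a'" and c': "c' = \<delta> a b + b * b * a'"
      using a0 by (simp_all add: abc' power2_eq_square)
    have 1: "a * ((p + a') * (s + c')) = (a * p + a * a') * s + (a * p + a * a') * \<delta> a b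
        + p * (a * a') * (b * b) + (a * a') * (b * b * a')"
      by (simp add: c' algebra_simps)
    have 2: "a * ((r1 + b') * (r4 + b') + r2 * r3)
        = a * r1 * r4 + (r1 + r4) * b * (a * a') + (b * b * a') * (a * a') + a * r2 * r3"
      by (simp add: b' algebra_simps)
    have "a * ((p + a') * (s + c') + ((r1 + b') * (r4 + b') + r2 * r3))
        = a * ((p + a') * (s + c')) + a * ((r1 + b') * (r4 + b') + r2 * r3)"
      by (rule distrib_left)
    also have "\<dots> = p * (a * \<delta> a b + b\<^sup>2) + \<delta> a b + (r1 + r4) * b + (p * s + r1 * r4 + r2 * r3) * a + s"
      unfolding 1 2 aa by (simp add: algebra_simps power2_eq_square)
    finally show ?thesis using ab by simp
  qed
  then have "(p + a') * (s + c') = (r1 + b') * (r4 + b') + r2 * r3"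
    using a0 by (simp add: add_eq_0_iff_eq)
  then obtain c1 c2 c3 c4 where c: "c1 \<noteq> 0 \<or> c2 \<noteq> 0 \<or> c3 \<noteq> 0 \<or> c4 \<noteq> 0"
    "(p + a') * c3 + (r1 + b') * c1 + r2 * c2 = 0" "(p + a') * c4 + r3 * c1 + (r4 + b') * c2 = 0"
    "(r4 + b') * c3 + r2 * c4 + (s + c') * c1 = 0" "r3 * c3 + (r1 + b') * c4 + (s + c') * c2 = 0"
    "k1 * c1 + k2 * c2 + k3 * c3 + k4 * c4 = 0"
    by (rule kernel_meets_hyperplane)
  define v where "v = c1 *s m1 + c2 *s m2 + c3 *s m3 + c4 *s m4"
  have vW: "v \<in> W" unfolding v_def by (intro subspace_add subspace_scale subW m)
  have BC: "B\<^sub>1 v = c1" "B\<^sub>2 v = c2" "C\<^sub>1 v = c3" "C\<^sub>2 v = c4" by (simp_all add: v_def m)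
  let ?k = "k1 * c1 + k2 * c2 + k3 * c3 + k4 * c4"
  \<comment> \<open>The correction terms \<open>ki * kj\<close> in \<open>p\<close>,
    \<open>s\<close> and the \<open>r\<close> add up to multiples of \<open>?k\<close>, which
    vanishes on the hyperplane.\<close>
  have "A\<^sub>1 v = p * c3 + r1 * c1 + r2 * c2 + k4 * ?k"
    "A\<^sub>2 v = p * c4 + r3 * c1 + r4 * c2 + k3 * ?k"
    "D\<^sub>1 v = r4 * c3 + r2 * c4 + s * c1 + k2 * ?k"
    "D\<^sub>2 v = r3 * c3 + r1 * c4 + s * c2 + k1 * ?k"
    unfolding v_def by (simp_all add: ps r D2m1 D1m2 A2m3 A1m4 D2m2 D2m3 D2m4 D1m3 D1m4 A2m4 algebra_simps)
  then have "A\<^sub>1 v + (a' * c3 + b' * c1) = 0" "A\<^sub>2 v + (a' * c4 + b' * c2) = 0"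
    "D\<^sub>1 v + (b' * c3 + c' * c1) = 0" "D\<^sub>2 v + (b' * c4 + c' * c2) = 0"
    using c(2-5) unfolding c(6) by (simp_all add: algebra_simps)
  then have AD: "A\<^sub>1 v = a' * c3 + b' * c1" "A\<^sub>2 v = a' * c4 + b' * c2"
    "D\<^sub>1 v = b' * c3 + c' * c1" "D\<^sub>2 v = b' * c4 + c' * c2"
    by (simp_all only: add_eq_0_iff_eq)
  have "v \<in> M a b" unfolding M_def using a0
    by (simp add: BC AD) (simp add: abc' algebra_simps power2_eq_square)
  then have "v \<in> W \<inter> M a b" using vW by blast
  moreover have "v \<noteq> 0" using c(1) BC by auto
  moreover have "M a b \<in> S" using a0 by (auto simp: S_def)
  ultimately show ?thesis by blast
qed

lemma symplectic_partial_spread_S: "symplectic_partial_spread S"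
  using orthogonal_partial_spread_S totally_singular_imp_totally_isotropic
  by (auto simp: orthogonal_partial_spread_def symplectic_partial_spread_def)

lemma maximal_symplectic_partial_spread_S: "maximal_symplectic_partial_spread S"
  unfolding maximal_symplectic_partial_spread_def
proof (intro conjI notI symplectic_partial_spread_S)
  assume "\<exists>T. symplectic_partial_spread T \<and> S \<subset> T"
  then obtain T W where T: "symplectic_partial_spread T" "S \<subseteq> T" "W \<in> T" "W \<notin> S" by blast
  then have "totally_isotropic W" "dim W = 4" by (auto simp: symplectic_partial_spread_def)
  then obtain X where "X \<in> S" "W \<inter> X \<noteq> {0}" using totally_isotropic_meets_S by blast
  then show False using T by (metis subsetD symplectic_partial_spread_def)
qed

lemma maximal_orthogonal_partial_spread_S: "maximal_orthogonal_partial_spread S"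
proof -
  have "symplectic_partial_spread T" if "orthogonal_partial_spread T" for T
    using that totally_singular_imp_totally_isotropic
    by (auto simp: orthogonal_partial_spread_def symplectic_partial_spread_def)
  then show ?thesis
    using maximal_symplectic_partial_spread_S orthogonal_partial_spread_S
    by (auto simp: maximal_symplectic_partial_spread_def maximal_orthogonal_partial_spread_def)
qed

end

section \<open>The Tits endomorphism as a power map\<close>

lemma finite_field_even_card_two_eq_0:
  assumes "card (UNIV :: 'a::{field,finite} set) = 2 ^ n"
  shows "(2::'a) = 0"
proof -
  \<comment> \<open>Translation by 1 permutes the field, so the number of its elements vanishes in
    it.\<close>
  have "(\<Sum>x\<in>UNIV. x + 1) = (\<Sum>x\<in>(UNIV::'a set). x)"
    by (rule sum.reindex_bij_witness[of _ "\<lambda>x. x - 1" "\<lambda>x. x + 1"]) auto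
  then have "of_nat (2 ^ n) = (0::'a)" by (simp add: sum.distrib assms)
  then show ?thesis by simp
qed

lemma finite_field_power_card:
  fixes x :: "'a::{field,finite}"
  shows "x ^ card (UNIV :: 'a set) = x"
proof (cases "x = 0")
  case False
  have "(\<Prod>y\<in>UNIV-{0}. x * y) = (\<Prod>y\<in>UNIV-{0}. y)"
    by (rule prod.reindex_bij_witness[of _ "\<lambda>y. y / x" "\<lambda>y. x * y"]) (use False in auto)
  then have "x ^ card (UNIV - {0::'a}) = 1" by (simp add: prod.distrib)
  then have "x * x ^ (card (UNIV :: 'a set) - 1) = x" by (simp add: card_Diff_singleton)
  then show ?thesis using finite_UNIV_card_ge_0[where 'a = 'a] by (simp flip: power_Suc)
qed (simp add: finite_UNIV_card_ge_0)

lemma power_2_power_add: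
  assumes "(2::'a::comm_ring_1) = 0"
  shows "((x::'a) + y) ^ 2 ^ n = x ^ 2 ^ n + y ^ 2 ^ n"
  by (induction n) (simp_all add: power_mult power2_sum assms power_Suc2 del: power_Suc)

text \<open>Applied twice, the map raises to the power \<open>2 ^ (2 * e + 2)\<close>, twice the
  field order, so it squares. An odd exponent above 1 makes the order at least 8.\<close>

lemma tits_endomorphism_power:
  assumes "card (UNIV :: 'a::{field,finite} set) = 2 ^ (2 * e + 1)" "2 ^ (2 * e + 1) > (2::nat)"
  shows "tits_endomorphism (\<lambda>x::'a. x ^ 2 ^ (e + 1))"
proof
  show two: "(2::'a) = 0" using assms(1) by (rule finite_field_even_card_two_eq_0)
  fix x y :: 'a
  show "(x + y) ^ 2 ^ (e + 1) = x ^ 2 ^ (e + 1) + y ^ 2 ^ (e + 1)"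
    using two by (rule power_2_power_add)
  show "(x * y) ^ 2 ^ (e + 1) = x ^ 2 ^ (e + 1) * y ^ 2 ^ (e + 1)"
    by (rule power_mult_distrib)
  have "(2::nat) ^ (e + 1) * 2 ^ (e + 1) = 2 ^ (2 * e + 1) * 2" by (simp add: mult_2[of e] power_add)
  then have "x ^ (2 ^ (e + 1) * 2 ^ (e + 1)) = x ^ (2 ^ (2 * e + 1) * 2)" by simp
  then have "(x ^ 2 ^ (e + 1)) ^ 2 ^ (e + 1) = (x ^ 2 ^ (2 * e + 1)) ^ 2" by (simp only: power_mult)
  then show "(x ^ 2 ^ (e + 1)) ^ 2 ^ (e + 1) = x\<^sup>2"
    using finite_field_power_card[of x] by (simp only: assms(1))
  have "e \<noteq> 0" using assms(2) by (intro notI) simp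
  then have "(2::nat) ^ 3 \<le> 2 ^ (2 * e + 1)" by (intro power_increasing) auto
  then show "card (UNIV :: 'a set) > 4" by (simp add: assms(1))
qed

theorem theorem7p13:
  fixes scale :: "'a::{field,finite} \<Rightarrow> 'v::ab_group_add \<Rightarrow> 'v"
    and Q :: "'v \<Rightarrow> 'a"
    and e q :: nat
  assumes "q = 2 ^ (2 * e + 1)" and "q > 2"
    and "card (UNIV :: 'a set) = q"
    and "O_plus_8_space scale Q"
  shows "\<exists>S. quadratic_space.maximal_orthogonal_partial_spread scale Q S
           \<and> card S = q\<^sup>2 - q + 1
           \<and> quadratic_space.maximal_symplectic_partial_spread scale Q S"
proof -
  obtain A\<^sub>1 A\<^sub>2 B\<^sub>1 B\<^sub>2 C\<^sub>1 C\<^sub>2 D\<^sub>1 D\<^sub>2 where "split_coordinates scale Q A\<^sub>1 A\<^sub>2 B\<^sub>1 B\<^sub>2 C\<^sub>1 C\<^sub>2 D\<^sub>1 D\<^sub>2"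
    using split_coordinates_exist[OF assms(4)] by blast
  moreover have "tits_endomorphism (\<lambda>x::'a. x ^ 2 ^ (e + 1))"
    using assms by (intro tits_endomorphism_power) auto
  ultimately interpret suzuki_tits_coordinates "\<lambda>x::'a. x ^ 2 ^ (e + 1)" scale Q A\<^sub>1 A\<^sub>2 B\<^sub>1 B\<^sub>2 C\<^sub>1 C\<^sub>2 D\<^sub>1 D\<^sub>2
    by (simp add: suzuki_tits_coordinates_def)
  show ?thesis
    using maximal_orthogonal_partial_spread_S card_S maximal_symplectic_partial_spread_S assms(3) by blast
qed

end
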